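(* Let $X\sim\Gamma(1,1)$ and let $p$ be a real number. For every integer $n\ge 0$, $$E\big[(X-1+p)^{n}\big]=D_{n}(p).$$
   Context: $X\sim\Gamma(1,1)$ means that $X$ is a gamma random variable with parameters $\alpha=1,\lambda=1$, i.e. a real random variable with density $f(x)=e^{-x}$ for $x\ge 0$ and $f(x)=0$ for $x<0$; $E$ denotes expectation. The derangement polynomials $D_n(x)$, $n\ge 0$, are defined by the generating function (formal power series in $t$) $\displaystyle\frac{e^{-t}}{1-t}e^{xt}=\sum_{n=0}^{\infty}D_{n}(x)\frac{t^{n}}{n!}$. *)

theory Defs
  imports "HOL-Probability.Probability" "HOL-Computational_Algebra.Computational_Algebra"
begin

(* The polynomial D_n is represented by its evaluation map; the generating function is the
   formal power series in t obtained for each fixed value of x. *)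
definition derangement_gf :: "real \<Rightarrow> real fps" where
  "derangement_gf x = fps_exp (-1) / (1 - fps_X) * fps_exp x"

definition derangement_poly :: "nat \<Rightarrow> real \<Rightarrow> real" where
  "derangement_poly n x = fact n * fps_nth (derangement_gf x) n"

lemma derangement_gf_eq: "derangement_gf x = Abs_fps (\<lambda>n. derangement_poly n x / fact n)"
  by (simp add: fps_eq_iff derangement_poly_def)

lemma derangement_poly_polynomial: "\<exists>q :: real poly. \<forall>x. derangement_poly n x = poly q x"
proof
  let ?c = "fps_nth (fps_exp (-1) / (1 - fps_X) :: real fps)"
  show "\<forall>x. derangement_poly n x =
      poly (\<Sum>i=0..n. monom (fact n * ?c i / fact (n - i)) (n - i)) x"
    by (simp add: derangement_poly_def derangement_gf_def fps_mult_nth poly_sum poly_monom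
        sum_distrib_left mult.assoc)
qed

definition gamma_1_1_density :: "real \<Rightarrow> real" where
  "gamma_1_1_density x = (if x \<ge> 0 then exp (- x) else 0)"

end

theory Submission
  imports Defs
begin

text \<open>
  The moments of a standard exponential variable are \<open>E[X\<^sup>i] = i!\<close>, so the exponential generating
  function of the moments is the geometric series \<open>1 / (1 - t)\<close>. A shift of \<open>X\<close> by a constant
  \<open>c\<close> is a binomial convolution of the moments with the powers of \<open>c\<close>, that is, multiplication of
  the generating function by \<open>e\<^bsup>ct\<^esup>\<close>. For \<open>c = x - 1\<close> the product is
  \<open>e\<^bsup>(x-1)t\<^esup> / (1 - t)\<close>, the generating function of the derangement polynomials.

  In terms of coefficients, both sides are binomial sums: \<open>derangement_poly_binomial_sum\<close> reads one
  off from the Cauchy product, and \<open>exponential_shifted_moment\<close> obtains the same sum from the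
  binomial theorem and linearity of expectation. Since only finite sums of moments occur, no
  question of convergence of the generating function arises.
\<close>

text \<open>The factors \<open>e\<^bsup>-t\<^esup>\<close> and \<open>e\<^bsup>xt\<^esup>\<close> combine, leaving the moment generating series of the
  exponential law times that of the constant \<open>x - 1\<close>.\<close>

lemma derangement_gf_geometric:
  "derangement_gf x = Abs_fps (\<lambda>_. 1) * fps_exp (x - 1)"
proof -
  have geometric: "inverse (1 - fps_X :: real fps) = Abs_fps (\<lambda>_. 1)"
    by (simp flip: fps_inverse_gp')
  have "derangement_gf x = inverse (1 - fps_X) * (fps_exp (- 1) * fps_exp x)"
    by (simp add: derangement_gf_def fps_divide_unit mult_ac)
  also have "fps_exp (- 1) * fps_exp x = fps_exp (x - 1)"
    by (simp flip: fps_exp_add_mult)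
  finally show ?thesis
    by (simp only: geometric)
qed

lemma derangement_poly_binomial_sum:
  "derangement_poly n x = (\<Sum>i\<le>n. of_nat (n choose i) * fact i * (x - 1) ^ (n - i))"
proof -
  have "derangement_poly n x = (\<Sum>i\<le>n. fact n * ((x - 1) ^ (n - i) / fact (n - i)))"
    by (simp add: derangement_poly_def derangement_gf_geometric fps_mult_nth sum_distrib_left
        atMost_atLeast0)
  also have "\<dots> = (\<Sum>i\<le>n. of_nat (n choose i) * fact i * (x - 1) ^ (n - i))"
    by (intro sum.cong) (simp_all add: binomial_fact)
  finally show ?thesis .
qed

text \<open>The exponential law is the Erlang law of shape parameter \<open>0\<close>, whose moments are known.\<close>

lemma gamma_1_1_density_eq_exponential: "gamma_1_1_density = exponential_density 1"
  by (auto simp: fun_eq_iff gamma_1_1_density_def exponential_density_def)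

text \<open>Stated as \<open>has_bochner_integral\<close> so that integrability and the value of the expectation both
  pass through the binomial expansion in one step.\<close>

lemma (in prob_space) exponential_shifted_moment:
  assumes "distributed M lborel X (exponential_density 1)"
  shows "has_bochner_integral M (\<lambda>\<omega>. (X \<omega> + c) ^ n)
    (\<Sum>i\<le>n. of_nat (n choose i) * fact i * c ^ (n - i))"
proof -
  have "has_bochner_integral M (\<lambda>\<omega>. X \<omega> ^ i) (fact i)" for i
    using has_bochner_integral_erlang_ith_moment[OF _ assms, of i] by simp
  then show ?thesis
    unfolding binomial_ring
    by (intro has_bochner_integral_sum has_bochner_integral_mult_left
        has_bochner_integral_mult_right)
qed

theorem theorem17:
  fixes M :: "'a measure" and X :: "'a \<Rightarrow> real" and p :: real and n :: nat
  assumes "prob_space M"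
    and "distributed M lborel X (\<lambda>x. ennreal (gamma_1_1_density x))"
  shows "integrable M (\<lambda>\<omega>. (X \<omega> - 1 + p) ^ n) \<and>
    prob_space.expectation M (\<lambda>\<omega>. (X \<omega> - 1 + p) ^ n) = derangement_poly n p"
proof -
  interpret prob_space M by fact
  have "has_bochner_integral M (\<lambda>\<omega>. (X \<omega> + (p - 1)) ^ n) (derangement_poly n p)"
    unfolding derangement_poly_binomial_sum
    using assms(2) by (intro exponential_shifted_moment)
      (simp add: gamma_1_1_density_eq_exponential)
  then have "has_bochner_integral M (\<lambda>\<omega>. (X \<omega> - 1 + p) ^ n) (derangement_poly n p)"
    by (simp add: algebra_simps)
  then show ?thesis
    by (simp add: has_bochner_integral_iff)
qed

end
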